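(* Let $(W,d)$ be a Hilbert complex with the compactness property, fix a level $k$, and let $l_1,\dots,l_5$ be bounded linear lower-order maps with associated operator $L:V^k\cap V^*_k\to (V^k\cap V^*_k)'$. Suppose $L$ is a bounded isomorphism and $$(d^*+l_2)L^{-1}(W^k)\subset V^{k-1},\qquad (d^*+l_3^* )(L')^{-1}(W^k)\subset V^{k-1}.$$ Then both the perturbed problem and its mixed formulation are well-posed. That is: (i) for every $f\in W^k$ there is a unique $u\in D$ with $Lu=f$; (ii) the bilinear form $B$ of the mixed formulation is well-posed, i.e. for any $(g,f)\in (V^{k-1})'\times (V^k)'$ there is a unique $(\sigma,u)\in V^{k-1}\times V^k$ such that $$B((\sigma,u),(\tau,v))=\langle g,\tau\rangle+\langle f,v\rangle\qquad\text{for all }(\tau,v)\in V^{k-1}\times V^k .$$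
   Context: A Hilbert complex $(W,d)$ is a sequence of (real) Hilbert spaces $W^k$ with closed densely defined linear operators $d=d^k:W^k\to W^{k+1}$ with closed range and $d^{k+1}\circ d^k=0$. Inner product and norm of $W$: $(\cdot,\cdot)$, $\|\cdot\|$. $V^k=D(d^k)$ with graph norm $\|v\|_V^2=\|v\|^2+\|dv\|^2$; $d^*=d^*_{k}:W^{k}\to W^{k-1}$ is the adjoint of $d^{k-1}$, with domain $V^*_k=D(d^*_k)$. $V^k\cap V^*_k$ carries the norm with square $\|v\|^2+\|dv\|^2+\|d^*v\|^2$. Compactness property: $V^k\cap V^*_k$ is compactly and densely embedded in $W^k$ (for each $k$). Identifying $W^k$ with its dual, $V^k\cap V^*_k\subset W^k\subset (V^k\cap V^*_k)'$. Lower-order terms: $l_1:W^k\to W^{k+1}$, $l_2:W^k\to W^{k-1}$, $l_3:W^{k-1}\to W^k$, $l_4:W^{k+1}\to W^k$, $l_5:W^k\to W^k$ are bounded linear maps, with adjoints $l_i^*$. The operator $L$ is $$\langle Lu,v\rangle=((d^*+l_2)u,(d^*+l_3^* )v)+((d+l_1)u,dv)+(l_4du,v)+(l_5u,v),\quad u,v\in V^k\cap V^*_k,$$ and $L'$ is its dual, $\langle L'z,v\rangle=\langle Lv,z\rangle$. Set $D=\{u\in V^k\cap V^*_k : (d^*+l_2)u\in V^{k-1},\ (d+l_1)u\in V^*_{k+1}\}$. The mixed formulation of $Lu=f$ ($f\in W^k$) seeks $(\sigma,u)\in V^{k-1}\times V^k$ with $B((\sigma,u),(\tau,v))=(f,v)$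 for all $(\tau,v)\in V^{k-1}\times V^k$, where $$B((\sigma,u),(\tau,v))=(\sigma,\tau)+(du,dv)+(d\sigma,v)-(u,d\tau)-(l_2u,\tau)+(l_3\sigma,v)+(l_1u,dv)+(l_4du,v)+(l_5u,v).$$ *)

theory Defs
  imports "HOL-Analysis.Analysis"
begin

text \<open>
  The spaces of a Hilbert complex are modelled as closed subspaces \<open>W k\<close> of one real Hilbert
  space \<open>'a\<close>, indexed by the integers. This is no restriction: any sequence of Hilbert spaces embeds
  isometrically into its Hilbert direct sum, and a complex that starts or ends at some level is
  continued by zero spaces. Operators between the spaces are functions \<open>'a \<Rightarrow> 'a\<close> whose values
  matter only on the stated domain; an unbounded operator is given together with its domain.
\<close>

definition linear_on :: "'a::real_vector set \<Rightarrow> ('a \<Rightarrow> 'b::real_vector) \<Rightarrow> bool" where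
  "linear_on S T \<longleftrightarrow>
     (\<forall>x\<in>S. \<forall>y\<in>S. T (x + y) = T x + T y) \<and> (\<forall>c. \<forall>x\<in>S. T (c *\<^sub>R x) = c *\<^sub>R T x)"

definition bounded_linear_map ::
    "'a::real_normed_vector set \<Rightarrow> 'b::real_normed_vector set \<Rightarrow> ('a \<Rightarrow> 'b) \<Rightarrow> bool" where
  "bounded_linear_map H1 H2 T \<longleftrightarrow>
     T ` H1 \<subseteq> H2 \<and> linear_on H1 T \<and> (\<exists>C. \<forall>x\<in>H1. norm (T x) \<le> C * norm x)"


subsection \<open>Hilbert space adjoints\<close>

text \<open>
  \<open>H1\<close>, \<open>H2\<close> are the Hilbert spaces and \<open>S \<subseteq> H1\<close> is the (dense) domain of \<open>T : S \<rightarrow> H2\<close>. Outside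
  \<open>adj_domain\<close> the value of \<open>adj\<close> is unspecified. For an everywhere defined operator, \<open>S = H1\<close>.
\<close>

definition adj_domain :: "'a::real_inner set \<Rightarrow> 'b::real_inner set \<Rightarrow> 'a set \<Rightarrow> ('a \<Rightarrow> 'b) \<Rightarrow> 'b set" where
  "adj_domain H1 H2 S T = {w \<in> H2. \<exists>z\<in>H1. \<forall>v\<in>S. T v \<bullet> w = v \<bullet> z}"

definition adj :: "'a::real_inner set \<Rightarrow> 'a set \<Rightarrow> ('a \<Rightarrow> 'b::real_inner) \<Rightarrow> 'b \<Rightarrow> 'a" where
  "adj H1 S T w = (THE z. z \<in> H1 \<and> (\<forall>v\<in>S. T v \<bullet> w = v \<bullet> z))"

lemma adj_unique:
  assumes "subspace H1" "S \<subseteq> H1" "H1 \<subseteq> closure S"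
    and "z \<in> H1" "\<forall>v\<in>S. T v \<bullet> w = v \<bullet> z"
  shows "adj H1 S T w = z"
  unfolding adj_def
proof (rule the_equality)
  show "z \<in> H1 \<and> (\<forall>v\<in>S. T v \<bullet> w = v \<bullet> z)" using assms by blast
  fix y assume y: "y \<in> H1 \<and> (\<forall>v\<in>S. T v \<bullet> w = v \<bullet> y)"
  have "closed {v. v \<bullet> (y - z) = 0}"
    by (intro closed_Collect_eq continuous_intros)
  moreover have "S \<subseteq> {v. v \<bullet> (y - z) = 0}"
    using y assms(5) by (auto simp: inner_diff_right)
  ultimately have "H1 \<subseteq> {v. v \<bullet> (y - z) = 0}"
    using assms(3) closure_minimal by blast
  moreover have "y - z \<in> H1"
    using y assms(1,4) by (simp add: subspace_diff)
  ultimately show "y = z" by auto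
qed


subsection \<open>Hilbert complexes\<close>

locale hilbert_complex =
  fixes W :: "int \<Rightarrow> 'a::{real_inner, complete_space} set"
    and V :: "int \<Rightarrow> 'a set"
    and d :: "int \<Rightarrow> 'a \<Rightarrow> 'a"
  assumes W_subspace: "subspace (W k)"
    and W_closed: "closed (W k)"
    and V_subspace: "subspace (V k)"
    and V_subset: "V k \<subseteq> W k"
    and V_dense: "W k \<subseteq> closure (V k)"
    and d_linear: "linear_on (V k) (d k)"
    and d_range: "d k ` V k \<subseteq> W (k + 1)"
    and d_closed_graph: "closed {(v, d k v) |v. v \<in> V k}"
    and d_closed_range: "closed (d k ` V k)"
    and d_maps_into_V: "v \<in> V k \<Longrightarrow> d k v \<in> V (k + 1)"
    and d_d: "v \<in> V k \<Longrightarrow> d (k + 1) (d k v) = 0"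

definition Vstar :: "(int \<Rightarrow> 'a::real_inner set) \<Rightarrow> (int \<Rightarrow> 'a set) \<Rightarrow> (int \<Rightarrow> 'a \<Rightarrow> 'a) \<Rightarrow> int \<Rightarrow> 'a set" where
  "Vstar W V d k = adj_domain (W (k - 1)) (W k) (V (k - 1)) (d (k - 1))"

definition dstar ::
    "(int \<Rightarrow> 'a::real_inner set) \<Rightarrow> (int \<Rightarrow> 'a set) \<Rightarrow> (int \<Rightarrow> 'a \<Rightarrow> 'a) \<Rightarrow> int \<Rightarrow> 'a \<Rightarrow> 'a" where
  "dstar W V d k = adj (W (k - 1)) (V (k - 1)) (d (k - 1))"

definition V_norm :: "(int \<Rightarrow> 'a::real_inner \<Rightarrow> 'a) \<Rightarrow> int \<Rightarrow> 'a \<Rightarrow> real" where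
  "V_norm d k v = sqrt ((norm v)\<^sup>2 + (norm (d k v))\<^sup>2)"

definition VVstar :: "(int \<Rightarrow> 'a::real_inner set) \<Rightarrow> (int \<Rightarrow> 'a set) \<Rightarrow> (int \<Rightarrow> 'a \<Rightarrow> 'a) \<Rightarrow> int \<Rightarrow> 'a set" where
  "VVstar W V d k = V k \<inter> Vstar W V d k"

definition VVstar_norm ::
    "(int \<Rightarrow> 'a::real_inner set) \<Rightarrow> (int \<Rightarrow> 'a set) \<Rightarrow> (int \<Rightarrow> 'a \<Rightarrow> 'a) \<Rightarrow> int \<Rightarrow> 'a \<Rightarrow> real" where
  "VVstar_norm W V d k v = sqrt ((norm v)\<^sup>2 + (norm (d k v))\<^sup>2 + (norm (dstar W V d k v))\<^sup>2)"

text \<open>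
  An embedding is compact if the image of the unit ball is relatively compact; since \<open>W k\<close> is
  closed in \<open>'a\<close>, the closure may be taken in \<open>'a\<close>.
\<close>

definition compactness_property ::
    "(int \<Rightarrow> 'a::real_inner set) \<Rightarrow> (int \<Rightarrow> 'a set) \<Rightarrow> (int \<Rightarrow> 'a \<Rightarrow> 'a) \<Rightarrow> bool" where
  "compactness_property W V d \<longleftrightarrow>
     (\<forall>k. W k \<subseteq> closure (VVstar W V d k) \<and>
          compact (closure {v \<in> VVstar W V d k. VVstar_norm W V d k v \<le> 1}))"


subsection \<open>Dual spaces\<close>

text \<open>
  \<open>X\<close> is a linear space with norm \<open>N\<close>. So that functionals that agree on \<open>X\<close> are equal, they are
  taken to be extensional, i.e. to have the value \<open>undefined\<close> outside \<open>X\<close>; this is why sums of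
  functionals are written pointwise in \<open>bounded_iso_to_dual\<close>.
\<close>

definition dual :: "'a::real_vector set \<Rightarrow> ('a \<Rightarrow> real) \<Rightarrow> ('a \<Rightarrow> real) set" where
  "dual X N = {\<phi> \<in> extensional X. linear_on X \<phi> \<and> (\<exists>C. \<forall>v\<in>X. \<bar>\<phi> v\<bar> \<le> C * N v)}"

definition dual_norm :: "'a set \<Rightarrow> ('a \<Rightarrow> real) \<Rightarrow> ('a \<Rightarrow> real) \<Rightarrow> real" where
  "dual_norm X N \<phi> = (SUP v\<in>{v \<in> X. N v \<le> 1}. \<bar>\<phi> v\<bar>)"

definition bounded_iso_to_dual ::
    "'a::real_vector set \<Rightarrow> ('a \<Rightarrow> real) \<Rightarrow> ('a \<Rightarrow> 'a \<Rightarrow> real) \<Rightarrow> bool" where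
  "bounded_iso_to_dual X N A \<longleftrightarrow>
     bij_betw A X (dual X N) \<and>
     (\<forall>v\<in>X. linear_on X (\<lambda>u. A u v)) \<and>
     (\<exists>C. \<forall>u\<in>X. dual_norm X N (A u) \<le> C * N u) \<and>
     (\<exists>C. \<forall>u\<in>X. N u \<le> C * dual_norm X N (A u))"

text \<open>The inclusion of \<open>W\<close> in the dual of \<open>X \<subseteq> W\<close> that comes from identifying \<open>W\<close> with its dual.\<close>

definition to_dual :: "'a::real_inner set \<Rightarrow> 'a \<Rightarrow> 'a \<Rightarrow> real" where
  "to_dual X f = (\<lambda>v\<in>X. f \<bullet> v)"


subsection \<open>The perturbed operator and its mixed formulation\<close>

definition L_op ::
    "(int \<Rightarrow> 'a::real_inner set) \<Rightarrow> (int \<Rightarrow> 'a set) \<Rightarrow> (int \<Rightarrow> 'a \<Rightarrow> 'a) \<Rightarrow> int \<Rightarrow>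
     ('a \<Rightarrow> 'a) \<Rightarrow> ('a \<Rightarrow> 'a) \<Rightarrow> ('a \<Rightarrow> 'a) \<Rightarrow> ('a \<Rightarrow> 'a) \<Rightarrow> ('a \<Rightarrow> 'a) \<Rightarrow> 'a \<Rightarrow> 'a \<Rightarrow> real" where
  "L_op W V d k l1 l2 l3 l4 l5 u = (\<lambda>v\<in>VVstar W V d k.
     (dstar W V d k u + l2 u) \<bullet> (dstar W V d k v + adj (W (k - 1)) (W (k - 1)) l3 v)
     + (d k u + l1 u) \<bullet> d k v + l4 (d k u) \<bullet> v + l5 u \<bullet> v)"

definition L_op_dual ::
    "(int \<Rightarrow> 'a::real_inner set) \<Rightarrow> (int \<Rightarrow> 'a set) \<Rightarrow> (int \<Rightarrow> 'a \<Rightarrow> 'a) \<Rightarrow> int \<Rightarrow>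
     ('a \<Rightarrow> 'a) \<Rightarrow> ('a \<Rightarrow> 'a) \<Rightarrow> ('a \<Rightarrow> 'a) \<Rightarrow> ('a \<Rightarrow> 'a) \<Rightarrow> ('a \<Rightarrow> 'a) \<Rightarrow> 'a \<Rightarrow> 'a \<Rightarrow> real" where
  "L_op_dual W V d k l1 l2 l3 l4 l5 z =
     (\<lambda>v\<in>VVstar W V d k. L_op W V d k l1 l2 l3 l4 l5 v z)"

definition L_domain ::
    "(int \<Rightarrow> 'a::real_inner set) \<Rightarrow> (int \<Rightarrow> 'a set) \<Rightarrow> (int \<Rightarrow> 'a \<Rightarrow> 'a) \<Rightarrow> int \<Rightarrow>
     ('a \<Rightarrow> 'a) \<Rightarrow> ('a \<Rightarrow> 'a) \<Rightarrow> 'a set" where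
  "L_domain W V d k l1 l2 =
     {u \<in> VVstar W V d k. dstar W V d k u + l2 u \<in> V (k - 1) \<and> d k u + l1 u \<in> Vstar W V d (k + 1)}"

definition preimage_W :: "'a::real_inner set \<Rightarrow> 'a set \<Rightarrow> ('a \<Rightarrow> 'a \<Rightarrow> real) \<Rightarrow> 'a set" where
  "preimage_W X H A = {u \<in> X. A u \<in> to_dual X ` H}"

definition B_form ::
    "(int \<Rightarrow> 'a::real_inner \<Rightarrow> 'a) \<Rightarrow> int \<Rightarrow>
     ('a \<Rightarrow> 'a) \<Rightarrow> ('a \<Rightarrow> 'a) \<Rightarrow> ('a \<Rightarrow> 'a) \<Rightarrow> ('a \<Rightarrow> 'a) \<Rightarrow> ('a \<Rightarrow> 'a) \<Rightarrow>
     'a \<times> 'a \<Rightarrow> 'a \<times> 'a \<Rightarrow> real" where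
  "B_form d k l1 l2 l3 l4 l5 = (\<lambda>(\<sigma>, u) (\<tau>, v).
     \<sigma> \<bullet> \<tau> + d k u \<bullet> d k v + d (k - 1) \<sigma> \<bullet> v - u \<bullet> d (k - 1) \<tau>
     - l2 u \<bullet> \<tau> + l3 \<sigma> \<bullet> v + l1 u \<bullet> d k v + l4 (d k u) \<bullet> v + l5 u \<bullet> v)"

end

theory Submission
  imports Defs
begin

text \<open>
  Represent \<open>g\<close> by \<open>\<gamma> \<in> V\<^sup>k\<^sup>-\<^sup>1\<close> and \<open>f\<close> by \<open>\<phi> \<in> V\<^sup>k\<close> in the graph inner products. The first mixed
  equation says that \<open>w = u + d\<gamma>\<close> lies in \<open>V\<^sup>k \<inter> V\<^sup>*\<^sub>k\<close> and that \<open>\<sigma> = d\<^sup>*w + l\<^sub>2u + \<gamma>\<close>; the second then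
  becomes \<open>Lw = F\<close> with \<open>F\<close> depending on \<open>\<gamma>\<close> and \<open>\<phi>\<close> only, which gives uniqueness. For existence,
  solve \<open>Lw = F\<close> and define \<open>\<sigma>\<close> by this formula. Testing with \<open>z \<in> d(V\<^sup>k\<^sup>-\<^sup>1) \<inter> V\<^sup>*\<^sub>k\<close>, where
  \<open>dz = 0\<close>, shows that \<open>z \<mapsto> (\<sigma>, d\<^sup>*z)\<close> is bounded in the norm of \<open>W\<^sup>k\<close>, and so \<open>\<sigma> \<in> V\<^sup>k\<^sup>-\<^sup>1\<close> because \<open>d\<close> is
  closed. The perturbed problem is the case \<open>g = 0\<close>, \<open>f \<in> W\<^sup>k\<close>.
\<close>

section \<open>Riesz representation and orthogonal projection\<close>

lemma linear_on_add: "linear_on S T \<Longrightarrow> x \<in> S \<Longrightarrow> y \<in> S \<Longrightarrow> T (x + y) = T x + T y"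
  and linear_on_scale: "linear_on S T \<Longrightarrow> x \<in> S \<Longrightarrow> T (c *\<^sub>R x) = c *\<^sub>R T x"
  by (auto simp: linear_on_def)

lemma linear_on_diff:
  assumes "linear_on S T" "subspace S" "x \<in> S" "y \<in> S"
  shows "T (x - y) = T x - T y"
proof -
  have "T (x + (-1) *\<^sub>R y) = T x + (-1) *\<^sub>R T y"
    using assms by (metis linear_on_add linear_on_scale subspace_scale)
  then show ?thesis by simp
qed

lemma linear_on_zero: "linear_on S T \<Longrightarrow> subspace S \<Longrightarrow> T 0 = 0"
  using linear_on_scale[of S T 0 0] subspace_0[of S] by simp

text \<open>The quadratic functional \<open>J\<close> is bounded below on \<open>S\<close>; the
  parallelogram identity makes a minimizing sequence Cauchy, and stationarity of \<open>J\<close> at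
  its limit is the representation.\<close>

lemma riesz_subspace:
  fixes S :: "'a::{real_inner, complete_space} set"
  assumes S: "subspace S" "closed S"
    and lin: "linear_on S \<phi>"
    and bd: "\<And>v. v \<in> S \<Longrightarrow> \<bar>\<phi> v\<bar> \<le> C * norm v"
  obtains z where "z \<in> S" "\<And>v. v \<in> S \<Longrightarrow> \<phi> v = z \<bullet> v"
proof -
  define J where "J v = v \<bullet> v - 2 * \<phi> v" for v
  define m where "m = Inf (J ` S)"
  \<comment> \<open>Completing the square: the bound on \<open>\<phi>\<close> gives
    \<open>J v \<ge> (norm v - C)\<^sup>2 - C\<^sup>2\<close>.\<close>
  have lower: "- C\<^sup>2 \<le> J v" if "v \<in> S" for v
  proof -
    have "0 \<le> (norm v - C)\<^sup>2" by simp
    then show ?thesis using bd[OF that]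
      by (simp add: J_def power2_diff dot_square_norm mult.commute)
  qed
  then have bdd: "bdd_below (J ` S)" by (auto simp: bdd_below_def)
  have m_le: "m \<le> J v" if "v \<in> S" for v
    unfolding m_def using bdd that by (intro cInf_lower) auto
  have ne: "J ` S \<noteq> {}" using subspace_0[OF S(1)] by auto
  have "\<exists>v\<in>S. J v < m + inverse (real (Suc n))" for n
    using cInf_lessD[OF ne, of "m + inverse (real (Suc n))"] by (auto simp: m_def)
  then obtain x where x: "\<And>n. x n \<in> S" "\<And>n. J (x n) < m + inverse (real (Suc n))" by metis
  \<comment> \<open>Parallelogram identity; the midpoint lies in \<open>S\<close>, so
    \<open>J\<close> there is at least \<open>m\<close>.\<close>
  have par: "(dist v w)\<^sup>2 \<le> 2 * (J v - m) + 2 * (J w - m)" if "v \<in> S" "w \<in> S" for v w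
  proof -
    have mid: "(1/2) *\<^sub>R (v + w) \<in> S" using that S(1) by (simp add: subspace_add subspace_scale)
    have "\<phi> ((1/2) *\<^sub>R (v + w)) = (\<phi> v + \<phi> w) / 2"
      using that S(1) linear_on_add[OF lin] linear_on_scale[OF lin] by (simp add: subspace_add)
    then have "(dist v w)\<^sup>2 = 2 * J v + 2 * J w - 4 * J ((1/2) *\<^sub>R (v + w))"
      by (simp add: J_def dist_norm power2_norm_eq_inner algebra_simps inner_commute)
    then show ?thesis using m_le[OF mid] by simp
  qed
  have "Cauchy x"
  proof (rule metric_CauchyI)
    fix e :: real assume e: "0 < e"
    \<comment> \<open>\<open>par\<close> counts each of two errors twice, hence the factor
      4.\<close>
    define c where "c = e\<^sup>2 / 4"
    have c: "0 < c" "e\<^sup>2 = 4 * c" using e by (simp_all add: c_def)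
    then obtain M where M: "inverse (real (Suc M)) < c"
      using reals_Archimedean by blast
    have small: "J (x n) - m < c" if "n \<ge> M" for n
    proof -
      have "inverse (real (Suc n)) \<le> inverse (real (Suc M))" using that by (simp add: field_simps)
      then show ?thesis using x(2)[of n] M by linarith
    qed
    have "dist (x i) (x j) < e" if "i \<ge> M" "j \<ge> M" for i j
    proof -
      have "(dist (x i) (x j))\<^sup>2 \<le> 2 * (J (x i) - m) + 2 * (J (x j) - m)"
        by (intro par x(1))
      also have "\<dots> < e\<^sup>2"
        using small[OF that(1)] small[OF that(2)] unfolding c(2) by argo
      finally show ?thesis using e by (simp add: power_less_imp_less_base)
    qed
    then show "\<exists>M. \<forall>i\<ge>M. \<forall>j\<ge>M. dist (x i) (x j) < e" by blast
  qed
  then obtain z where z: "x \<longlonglongrightarrow> z" using Cauchy_convergent convergent_def by blast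
  have zS: "z \<in> S" using closed_sequentially[OF S(2)] x(1) z by blast
  have "(\<lambda>n. \<phi> (x n)) \<longlonglongrightarrow> \<phi> z"
  proof (rule Lim_null_comparison[THEN LIM_zero_cancel])
    show "\<forall>\<^sub>F n in sequentially. norm (\<phi> (x n) - \<phi> z) \<le> C * norm (x n - z)"
      using bd[of "x _ - z"] linear_on_diff[OF lin S(1) x(1) zS] subspace_diff[OF S(1) x(1) zS] by simp
    show "(\<lambda>n. C * norm (x n - z)) \<longlonglongrightarrow> 0"
      using tendsto_mult[OF tendsto_const[of C] tendsto_norm[OF LIM_zero[OF z]]] by simp
  qed
  then have "(\<lambda>n. J (x n)) \<longlonglongrightarrow> J z" unfolding J_def by (intro tendsto_intros z)
  moreover have "(\<lambda>n. m + inverse (real (Suc n))) \<longlonglongrightarrow> m + 0"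
    by (intro tendsto_intros LIMSEQ_inverse_real_of_nat)
  ultimately have Jz: "J z \<le> m"
    using LIMSEQ_le[of "\<lambda>n. J (x n)" "J z" "\<lambda>n. m + inverse (real (Suc n))" m] x(2) less_imp_le by auto
  have "\<phi> v = z \<bullet> v" if v: "v \<in> S" for v
  proof (cases "v = 0")
    case True then show ?thesis using linear_on_scale[OF lin v, of 0] by simp
  next
    case False
    define a where "a = z \<bullet> v - \<phi> v"
    \<comment> \<open>This \<open>t\<close> minimizes \<open>J\<close> along the line through
      \<open>z\<close> in direction \<open>v\<close>, lowering its value by
      \<open>a\<^sup>2 / (v \<bullet> v)\<close>; minimality of \<open>J z\<close> then forces
      \<open>a = 0\<close>.\<close>
    define t where "t = - a / (v \<bullet> v)"
    have vv: "v \<bullet> v > 0" using False by simp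
    have "z + t *\<^sub>R v \<in> S" using zS v S(1) by (simp add: subspace_add subspace_scale)
    then have "J z \<le> J (z + t *\<^sub>R v)" using m_le Jz by (meson order_trans)
    also have "\<phi> (z + t *\<^sub>R v) = \<phi> z + t * \<phi> v"
      using linear_on_add[OF lin zS subspace_scale[OF S(1) v]] linear_on_scale[OF lin v] by simp
    then have "J (z + t *\<^sub>R v) = J z + 2 * t * a + t * (t * (v \<bullet> v))"
      by (simp add: J_def a_def algebra_simps inner_commute)
    also have "\<dots> = J z - a\<^sup>2 / (v \<bullet> v)"
      using vv by (simp add: t_def field_simps power2_eq_square)
    finally have "a\<^sup>2 / (v \<bullet> v) \<le> 0" by simp
    then have "a\<^sup>2 \<le> 0" using vv by (simp add: divide_le_0_iff)
    then show ?thesis by (simp add: a_def)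
  qed
  with zS that show thesis by blast
qed

text \<open>The projection is the Riesz representative in \<open>S\<close> of the functional
  \<open>v \<mapsto> x \<bullet> v\<close>.\<close>

lemma orthogonal_projection:
  fixes S :: "'a::{real_inner, complete_space} set"
  assumes "subspace S" "closed S"
  obtains z where "z \<in> S" "\<And>v. v \<in> S \<Longrightarrow> (x - z) \<bullet> v = 0"
proof -
  have "linear_on S ((\<bullet>) x)" by (simp add: linear_on_def inner_add_right)
  then obtain z where "z \<in> S" "\<And>v. v \<in> S \<Longrightarrow> x \<bullet> v = z \<bullet> v"
    using riesz_subspace[OF assms, of "(\<bullet>) x" "norm x"] Cauchy_Schwarz_ineq2 by metis
  then show thesis using that by (auto simp: inner_diff_left)
qed


section \<open>Hilbert complexes\<close>

context hilbert_complex
begin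

lemma d_add: "x \<in> V j \<Longrightarrow> y \<in> V j \<Longrightarrow> d j (x + y) = d j x + d j y"
  and d_scale: "x \<in> V j \<Longrightarrow> d j (c *\<^sub>R x) = c *\<^sub>R d j x"
  and d_diff: "x \<in> V j \<Longrightarrow> y \<in> V j \<Longrightarrow> d j (x - y) = d j x - d j y"
  using d_linear[of j] V_subspace[of j]
  by (auto intro: linear_on_add linear_on_scale linear_on_diff)

lemma d_in_W: "v \<in> V (j - 1) \<Longrightarrow> d (j - 1) v \<in> W j"
  and d_in_V: "v \<in> V (j - 1) \<Longrightarrow> d (j - 1) v \<in> V j"
  and d_d_eq_0: "v \<in> V (j - 1) \<Longrightarrow> d j (d (j - 1) v) = 0"
  using d_range[of "j - 1"] d_maps_into_V[of v "j - 1"] d_d[of v "j - 1"] by auto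

lemma V_in_W: "v \<in> V j \<Longrightarrow> v \<in> W j"
  using V_subset by blast

text \<open>Together with \<open>d_closed_graph\<close>, it lets Riesz representation and projection
  be applied inside the graph, where the norm of the product space is the graph norm of
  \<open>V j\<close>.\<close>

lemma subspace_graph: "subspace {(v, d j v) |v. v \<in> V j}"
proof (rule subspaceI)
  show "0 \<in> {(v, d j v) |v. v \<in> V j}"
    using subspace_0[OF V_subspace] d_scale[OF subspace_0[OF V_subspace], where c=0]
    by (auto simp: zero_prod_def)
qed (use V_subspace[of j] in \<open>auto simp: d_add d_scale subspace_add subspace_scale\<close>)

lemma subspace_range: "subspace (d j ` V j)"
proof -
  have "d j ` V j = snd ` {(v, d j v) |v. v \<in> V j}" by force
  then show ?thesis using linear_subspace_image[OF linear_snd subspace_graph] by simp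
qed

section \<open>The adjoint of \<open>d\<close>: domain, values and linearity\<close>

text \<open>Density of \<open>V (j - 1)\<close> makes the witness \<open>z\<close> unique, so it is
  the value picked by the definite description in \<open>adj\<close>.\<close>

lemma VstarI:
  assumes "w \<in> W j" "z \<in> W (j - 1)" "\<And>v. v \<in> V (j - 1) \<Longrightarrow> d (j - 1) v \<bullet> w = v \<bullet> z"
  shows "w \<in> Vstar W V d j" "dstar W V d j w = z"
proof -
  show "w \<in> Vstar W V d j" using assms by (auto simp: Vstar_def adj_domain_def)
  show "dstar W V d j w = z" unfolding dstar_def
    using assms by (intro adj_unique W_subspace V_subset V_dense) auto
qed

lemma VstarD:
  assumes "w \<in> Vstar W V d j"
  shows "w \<in> W j" "dstar W V d j w \<in> W (j - 1)"
    "\<And>v. v \<in> V (j - 1) \<Longrightarrow> d (j - 1) v \<bullet> w = v \<bullet> dstar W V d j w"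
proof -
  obtain z where z: "z \<in> W (j - 1)" "\<forall>v\<in>V (j - 1). d (j - 1) v \<bullet> w = v \<bullet> z" and w: "w \<in> W j"
    using assms by (auto simp: Vstar_def adj_domain_def)
  have "dstar W V d j w = z" using VstarI(2)[OF w z(1)] z(2) by blast
  then show "w \<in> W j" "dstar W V d j w \<in> W (j - 1)"
    "\<And>v. v \<in> V (j - 1) \<Longrightarrow> d (j - 1) v \<bullet> w = v \<bullet> dstar W V d j w"
    using z w by auto
qed

lemma
  assumes "x \<in> Vstar W V d j" "y \<in> Vstar W V d j"
  shows Vstar_add: "x + y \<in> Vstar W V d j"
    and dstar_add: "dstar W V d j (x + y) = dstar W V d j x + dstar W V d j y"
proof -
  have "x + y \<in> W j" "dstar W V d j x + dstar W V d j y \<in> W (j - 1)"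
    using VstarD(1,2) assms W_subspace by (blast intro: subspace_add)+
  moreover have "d (j - 1) v \<bullet> (x + y) = v \<bullet> (dstar W V d j x + dstar W V d j y)"
    if "v \<in> V (j - 1)" for v
    using VstarD(3)[OF assms(1) that] VstarD(3)[OF assms(2) that] by (simp add: inner_add_right)
  ultimately show "x + y \<in> Vstar W V d j" "dstar W V d j (x + y) = dstar W V d j x + dstar W V d j y"
    by (fact VstarI)+
qed

lemma
  assumes "x \<in> Vstar W V d j"
  shows Vstar_scale: "c *\<^sub>R x \<in> Vstar W V d j"
    and dstar_scale: "dstar W V d j (c *\<^sub>R x) = c *\<^sub>R dstar W V d j x"
  using VstarD[OF assms] W_subspace
    VstarI[of "c *\<^sub>R x" j "c *\<^sub>R dstar W V d j x"]
  by (simp_all add: subspace_scale)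

lemma
  assumes "x \<in> Vstar W V d j" "y \<in> Vstar W V d j"
  shows Vstar_diff: "x - y \<in> Vstar W V d j"
    and dstar_diff: "dstar W V d j (x - y) = dstar W V d j x - dstar W V d j y"
proof -
  have "x - y \<in> W j" "dstar W V d j x - dstar W V d j y \<in> W (j - 1)"
    using VstarD(1,2) assms W_subspace by (blast intro: subspace_diff)+
  moreover have "d (j - 1) v \<bullet> (x - y) = v \<bullet> (dstar W V d j x - dstar W V d j y)"
    if "v \<in> V (j - 1)" for v
    using VstarD(3)[OF assms(1) that] VstarD(3)[OF assms(2) that] by (simp add: inner_diff_right)
  ultimately show "x - y \<in> Vstar W V d j" "dstar W V d j (x - y) = dstar W V d j x - dstar W V d j y"
    by (fact VstarI)+
qed

section \<open>Splitting along the range of \<open>d\<close>, and membership in \<open>V\<close> by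
  duality\<close>

text \<open>\<open>b\<close> is the projection of \<open>v\<close> onto the closed range of
  \<open>d (j - 1)\<close>; for elements of \<open>W j\<close>, being orthogonal to that range means
  lying in the kernel of the adjoint.\<close>

lemma hodge_splitting:
  assumes "v \<in> W j"
  obtains b where "b \<in> d (j - 1) ` V (j - 1)" "v - b \<in> Vstar W V d j" "dstar W V d j (v - b) = 0"
proof -
  obtain b where b: "b \<in> d (j - 1) ` V (j - 1)" "\<And>y. y \<in> d (j - 1) ` V (j - 1) \<Longrightarrow> (v - b) \<bullet> y = 0"
    using orthogonal_projection[OF subspace_range d_closed_range] by blast
  have "v - b \<in> W j" using b(1) d_in_W assms W_subspace by (blast intro: subspace_diff)
  then show thesis using that[OF b(1)] b(2) subspace_0[OF W_subspace]
    by (metis VstarI image_eqI inner_commute inner_zero_right)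
qed

text \<open>
  The inclusion \<open>D(d\<^sup>*\<^sup>*) \<subseteq> D(d)\<close>: the component of \<open>(s, m)\<close> orthogonal to the graph of \<open>d\<close> has the
  form \<open>(-d\<^sup>*c, c)\<close>, and pairing the hypothesis with \<open>c\<close> makes it vanish.
\<close>

lemma V_eq_biadjoint:
  assumes s: "s \<in> W (j - 1)" and m: "m \<in> W j"
    and eq: "\<And>z. z \<in> Vstar W V d j \<Longrightarrow> s \<bullet> dstar W V d j z = m \<bullet> z"
  shows "s \<in> V (j - 1)" "d (j - 1) s = m"
proof -
  obtain p where p: "p \<in> {(v, d (j - 1) v) |v. v \<in> V (j - 1)}"
    "\<And>y. y \<in> {(v, d (j - 1) v) |v. v \<in> V (j - 1)} \<Longrightarrow> ((s, m) - p) \<bullet> y = 0"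
    using orthogonal_projection[OF subspace_graph d_closed_graph] by blast
  then obtain a where a: "p = (a, d (j - 1) a)" "a \<in> V (j - 1)" by auto
  define c where "c = m - d (j - 1) a"
  have orth: "(s - a) \<bullet> v + c \<bullet> d (j - 1) v = 0" if "v \<in> V (j - 1)" for v
    using p(2)[of "(v, d (j - 1) v)"] that by (auto simp: a c_def)
  have "c \<in> W j" "a - s \<in> W (j - 1)"
    using s m a(2) d_in_W V_in_W W_subspace by (auto simp: c_def intro: subspace_diff)
  moreover have "d (j - 1) v \<bullet> c = v \<bullet> (a - s)" if "v \<in> V (j - 1)" for v
    using orth[OF that] by (simp add: inner_commute algebra_simps)
  ultimately have c: "c \<in> Vstar W V d j" "dstar W V d j c = a - s" by (auto intro: VstarI)
  have "d (j - 1) a \<bullet> c = a \<bullet> (a - s)" using VstarD(3)[OF c(1) a(2)] c(2) by simp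
  then have "(s - a) \<bullet> (a - s) = c \<bullet> c"
    using eq[OF c(1)] c(2) by (simp add: c_def inner_diff_left)
  then have "(s - a) \<bullet> (s - a) + c \<bullet> c = 0" by (simp add: algebra_simps)
  then have "s = a \<and> c = 0"
    using inner_ge_zero[of "s - a"] inner_ge_zero[of c] by (smt (verit) inner_eq_zero_iff eq_iff_diff_eq_0)
  then show "s \<in> V (j - 1)" "d (j - 1) s = m" using a(2) by (auto simp: c_def)
qed

text \<open>Let \<open>n\<close> be the projection of \<open>m\<close> onto the range. Removing from
  \<open>z\<close> its part in the kernel of the adjoint leaves \<open>b\<close> in the range, and
  both sides of \<open>s \<bullet> dstar W V d j z = n \<bullet> z\<close> are unchanged; so the
  biadjoint argument yields \<open>d (j - 1) s = n\<close>. Hence \<open>m\<close> is recovered only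
  up to a part orthogonal to the range.\<close>

lemma V_by_testing_on_range:
  assumes s: "s \<in> W (j - 1)" and m: "m \<in> W j"
    and eq: "\<And>z. z \<in> Vstar W V d j \<Longrightarrow> z \<in> d (j - 1) ` V (j - 1) \<Longrightarrow> s \<bullet> dstar W V d j z = m \<bullet> z"
  shows "s \<in> V (j - 1)" "\<And>b. b \<in> d (j - 1) ` V (j - 1) \<Longrightarrow> d (j - 1) s \<bullet> b = m \<bullet> b"
proof -
  obtain n where n: "n \<in> d (j - 1) ` V (j - 1)" "m - n \<in> Vstar W V d j" "dstar W V d j (m - n) = 0"
    using hodge_splitting[OF m] by blast
  have orth: "(m - n) \<bullet> b = 0" if "b \<in> d (j - 1) ` V (j - 1)" for b
    using VstarD(3)[OF n(2)] n(3) that by (auto simp: inner_commute)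
  have "s \<bullet> dstar W V d j z = n \<bullet> z" if z: "z \<in> Vstar W V d j" for z
  proof -
    obtain b where b: "b \<in> d (j - 1) ` V (j - 1)" "z - b \<in> Vstar W V d j" "dstar W V d j (z - b) = 0"
      using hodge_splitting[OF VstarD(1)[OF z]] by blast
    have bV: "b \<in> Vstar W V d j" "dstar W V d j b = dstar W V d j z"
      using Vstar_diff[OF z b(2)] dstar_diff[OF z b(2)] b(3) by auto
    have "n \<bullet> (z - b) = 0" using VstarD(3)[OF b(2)] b(3) n(1) by auto
    then show ?thesis using eq[OF bV(1) b(1)] orth[OF b(1)] bV(2) by (simp add: algebra_simps)
  qed
  moreover have "n \<in> W j" using n(1) d_in_W by blast
  ultimately have "s \<in> V (j - 1)" "d (j - 1) s = n" using V_eq_biadjoint[OF s] by blast+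
  then show "s \<in> V (j - 1)" "\<And>b. b \<in> d (j - 1) ` V (j - 1) \<Longrightarrow> d (j - 1) s \<bullet> b = m \<bullet> b"
    using orth by (auto simp: inner_diff_left)
qed

section \<open>Functionals on \<open>V\<close> and on \<open>VVstar\<close>\<close>

text \<open>Riesz representation in the graph, applied to \<open>g \<circ> fst\<close>.\<close>

lemma V_dual_representation:
  assumes "g \<in> dual (V j) (V_norm d j)"
  obtains \<gamma> where "\<gamma> \<in> V j" "\<And>v. v \<in> V j \<Longrightarrow> g v = \<gamma> \<bullet> v + d j \<gamma> \<bullet> d j v"
proof -
  let ?G = "{(v, d j v) |v. v \<in> V j}"
  obtain C where lin: "linear_on (V j) g" and C: "\<And>v. v \<in> V j \<Longrightarrow> \<bar>g v\<bar> \<le> C * V_norm d j v"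
    using assms by (auto simp: dual_def)
  have "linear_on ?G (g \<circ> fst)" using lin by (auto simp: linear_on_def)
  moreover have "\<bar>(g \<circ> fst) p\<bar> \<le> C * norm p" if "p \<in> ?G" for p
    using that C by (auto simp: V_norm_def norm_prod_def)
  ultimately obtain q where q: "q \<in> ?G" "\<And>p. p \<in> ?G \<Longrightarrow> (g \<circ> fst) p = q \<bullet> p"
    using riesz_subspace[OF subspace_graph d_closed_graph, of j "g \<circ> fst" C] by blast
  then obtain \<gamma> where \<gamma>: "\<gamma> \<in> V j" "q = (\<gamma>, d j \<gamma>)" by blast
  have "g v = \<gamma> \<bullet> v + d j \<gamma> \<bullet> d j v" if "v \<in> V j" for v
    using q(2)[of "(v, d j v)"] that by (auto simp: \<gamma>(2))
  with \<gamma>(1) show thesis by (rule that)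
qed

text \<open>Each of the three norms is at most \<open>VVstar_norm\<close>, so Cauchy-Schwarz applies
  termwise. This makes the loads below admissible right-hand sides for \<open>L\<close>.\<close>

lemma VVstar_dual_functional:
  "(\<lambda>v\<in>VVstar W V d j. a \<bullet> v + b \<bullet> d j v + c \<bullet> dstar W V d j v)
     \<in> dual (VVstar W V d j) (VVstar_norm W V d j)"
proof -
  let ?X = "VVstar W V d j"
  let ?F = "\<lambda>v\<in>?X. a \<bullet> v + b \<bullet> d j v + c \<bullet> dstar W V d j v"
  have X: "x + y \<in> ?X" "r *\<^sub>R x \<in> ?X" if "x \<in> ?X" "y \<in> ?X" for x y r
    using that V_subspace by (auto simp: VVstar_def Vstar_add Vstar_scale subspace_add subspace_scale)
  have "linear_on ?X ?F"
    unfolding linear_on_def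
  proof (intro conjI ballI allI)
    show "?F (x + y) = ?F x + ?F y" if "x \<in> ?X" "y \<in> ?X" for x y
      using that X(1)[OF that] by (simp add: VVstar_def d_add dstar_add inner_add_right)
    show "?F (r *\<^sub>R x) = r *\<^sub>R ?F x" if "x \<in> ?X" for r x
      using that X(2)[OF that that] by (simp add: VVstar_def d_scale dstar_scale distrib_left)
  qed
  moreover have "\<bar>?F v\<bar> \<le> (norm a + norm b + norm c) * VVstar_norm W V d j v" if "v \<in> ?X" for v
  proof -
    let ?N = "VVstar_norm W V d j v"
    have N: "norm v \<le> ?N" "norm (d j v) \<le> ?N" "norm (dstar W V d j v) \<le> ?N"
      unfolding VVstar_norm_def by (auto intro!: real_le_rsqrt)
    have "\<bar>x \<bullet> y\<bar> \<le> norm x * ?N" if "norm y \<le> ?N" for x y :: 'a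
      using Cauchy_Schwarz_ineq2[of x y] mult_left_mono[OF that norm_ge_zero[of x]] by linarith
    from this[OF N(1), of a] this[OF N(2), of b] this[OF N(3), of c]
    show ?thesis using that by (simp add: distrib_right)
  qed
  ultimately show ?thesis by (auto simp: dual_def)
qed

end


section \<open>The perturbed problem\<close>

locale perturbed_complex = hilbert_complex W V d
  for W V :: "int \<Rightarrow> 'a::{real_inner, complete_space} set" and d :: "int \<Rightarrow> 'a \<Rightarrow> 'a" +
  fixes k :: int and l1 l2 l3 l4 l5 :: "'a \<Rightarrow> 'a"
  assumes l1: "bounded_linear_map (W k) (W (k + 1)) l1"
    and l2: "bounded_linear_map (W k) (W (k - 1)) l2"
    and l3: "bounded_linear_map (W (k - 1)) (W k) l3"
    and l4: "bounded_linear_map (W (k + 1)) (W k) l4"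
    and l5: "bounded_linear_map (W k) (W k) l5"
begin

abbreviation "X \<equiv> VVstar W V d k"
abbreviation "\<delta> \<equiv> dstar W V d k"
abbreviation "L \<equiv> L_op W V d k l1 l2 l3 l4 l5"
abbreviation "B \<equiv> B_form d k l1 l2 l3 l4 l5"

section \<open>Lower-order terms and the action of \<open>L\<close>\<close>

lemma maps:
  "x \<in> W k \<Longrightarrow> l2 x \<in> W (k - 1)" "y \<in> W (k - 1) \<Longrightarrow> l3 y \<in> W k"
  "z \<in> W (k + 1) \<Longrightarrow> l4 z \<in> W k" "x \<in> W k \<Longrightarrow> l5 x \<in> W k"
  using l2 l3 l4 l5 by (auto simp: bounded_linear_map_def)

lemma l_diff:
  assumes "x \<in> W k" "y \<in> W k"
  shows "l1 (x - y) = l1 x - l1 y" "l2 (x - y) = l2 x - l2 y" "l5 (x - y) = l5 x - l5 y"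
  using l1 l2 l5 W_subspace[of k] assms by (auto simp: bounded_linear_map_def intro: linear_on_diff)

text \<open>The value of \<open>adj\<close> is known only once some element has the adjoint
  property; Riesz representation in \<open>W (k - 1)\<close> supplies it.\<close>

lemma l3_adjoint:
  assumes v: "v \<in> W k" and s: "s \<in> W (k - 1)"
  shows "s \<bullet> adj (W (k - 1)) (W (k - 1)) l3 v = l3 s \<bullet> v"
proof -
  obtain C where lin: "linear_on (W (k - 1)) l3" and C: "\<And>x. x \<in> W (k - 1) \<Longrightarrow> norm (l3 x) \<le> C * norm x"
    using l3 by (auto simp: bounded_linear_map_def)
  have "linear_on (W (k - 1)) (\<lambda>x. l3 x \<bullet> v)"
    using lin by (auto simp: linear_on_def inner_add_left)
  moreover have "\<bar>l3 x \<bullet> v\<bar> \<le> (C * norm v) * norm x" if "x \<in> W (k - 1)" for x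
  proof -
    have "\<bar>l3 x \<bullet> v\<bar> \<le> norm (l3 x) * norm v" by (rule Cauchy_Schwarz_ineq2)
    also have "\<dots> \<le> C * norm x * norm v" by (intro mult_right_mono C that) simp
    finally show ?thesis by (simp add: mult_ac)
  qed
  ultimately obtain z where z: "z \<in> W (k - 1)" "\<And>x. x \<in> W (k - 1) \<Longrightarrow> l3 x \<bullet> v = z \<bullet> x"
    using riesz_subspace[OF W_subspace W_closed, of "k - 1" "\<lambda>x. l3 x \<bullet> v" "C * norm v"] by blast
  then have "adj (W (k - 1)) (W (k - 1)) l3 v = z"
    by (intro adj_unique) (auto simp: W_subspace closure_subset inner_commute)
  then show ?thesis using z(2)[OF s] by (simp add: inner_commute)
qed

text \<open>Moving \<open>l3\<close> off the test function brings \<open>L\<close> into the shape of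
  the second equation of \<open>B\<close>.\<close>

lemma L_apply:
  assumes u: "u \<in> X" and v: "v \<in> X"
  shows "L u v = (\<delta> u + l2 u) \<bullet> \<delta> v + l3 (\<delta> u + l2 u) \<bullet> v
    + (d k u + l1 u) \<bullet> d k v + l4 (d k u) \<bullet> v + l5 u \<bullet> v"
proof -
  have "\<delta> u + l2 u \<in> W (k - 1)"
    using u VstarD maps(1) W_subspace by (auto simp: VVstar_def intro!: subspace_add)
  then show ?thesis
    using l3_adjoint[of v "\<delta> u + l2 u"] v V_in_W by (simp add: L_op_def VVstar_def inner_add_right)
qed

lemma L_extensional: "L u \<in> extensional X"
  by (simp add: L_op_def)

text \<open>The functional \<open>F\<close> of the shifted problem \<open>L (u + d\<gamma>) = F\<close>, for \<open>\<langle>f, v\<rangle> = (p, v) + (q, dv)\<close>.\<close>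

definition shifted_load :: "'a \<Rightarrow> 'a \<Rightarrow> 'a \<Rightarrow> 'a \<Rightarrow> real" where
  "shifted_load \<gamma> p q = (\<lambda>v\<in>X.
     (l3 (l2 (d (k - 1) \<gamma>) - \<gamma>) + p + l5 (d (k - 1) \<gamma>)) \<bullet> v
     + (q + l1 (d (k - 1) \<gamma>)) \<bullet> d k v + (l2 (d (k - 1) \<gamma>) - \<gamma>) \<bullet> \<delta> v)"

lemma shifted_load_in_dual: "shifted_load \<gamma> p q \<in> dual X (VVstar_norm W V d k)"
  unfolding shifted_load_def by (rule VVstar_dual_functional)

lemma shifted_load_extensional: "shifted_load \<gamma> p q \<in> extensional X"
  by (simp add: shifted_load_def)

text \<open>Since \<open>d k\<close> kills \<open>d (k - 1) \<gamma>\<close>, replacing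
  \<open>u\<close> by \<open>w\<close> leaves \<open>d k u\<close> and the \<open>l4\<close> term
  alone; the changes in the other lower-order terms, and \<open>\<gamma>\<close> itself, are what
  \<open>shifted_load\<close> collects.\<close>

lemma L_eq_shifted_load_iff:
  assumes \<gamma>: "\<gamma> \<in> V (k - 1)" and w: "w \<in> X"
    and u: "u = w - d (k - 1) \<gamma>" and \<sigma>: "\<sigma> = \<delta> w + l2 u + \<gamma>"
  shows "L w = shifted_load \<gamma> p q \<longleftrightarrow>
    (\<forall>v\<in>X. \<sigma> \<bullet> \<delta> v + l3 \<sigma> \<bullet> v + (d k u + l1 u) \<bullet> d k v + l4 (d k u) \<bullet> v + l5 u \<bullet> v
       = p \<bullet> v + q \<bullet> d k v)" (is "_ \<longleftrightarrow> (\<forall>v\<in>X. ?P v)")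
proof -
  let ?e = "d (k - 1) \<gamma>"
  have W: "w \<in> W k" "?e \<in> W k" "\<gamma> \<in> W (k - 1)" "\<delta> w \<in> W (k - 1)"
    using w \<gamma> VstarD V_in_W d_in_W by (auto simp: VVstar_def)
  have du: "d k (w - ?e) = d k w"
    using w d_in_V[OF \<gamma>] d_d_eq_0[OF \<gamma>] by (simp add: VVstar_def d_diff)
  have s: "\<sigma> = (\<delta> w + l2 w) - (l2 ?e - \<gamma>)" using l_diff(2) W by (simp add: u \<sigma>)
  have l3s: "l3 \<sigma> = l3 (\<delta> w + l2 w) - l3 (l2 ?e - \<gamma>)"
    unfolding s using l3 W maps W_subspace[of "k - 1"]
    by (auto simp: bounded_linear_map_def intro!: linear_on_diff subspace_add subspace_diff)
  have "L w v = shifted_load \<gamma> p q v \<longleftrightarrow> ?P v" if v: "v \<in> X" for v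
    unfolding L_apply[OF w v] l3s u du l_diff[OF W(1,2)]
    using v by (simp add: s shifted_load_def algebra_simps)
  moreover have "L w = shifted_load \<gamma> p q \<longleftrightarrow> (\<forall>v\<in>X. L w v = shifted_load \<gamma> p q v)"
    using extensionalityI[OF L_extensional shifted_load_extensional] by auto
  ultimately show ?thesis by auto
qed

section \<open>Equivalence of the mixed and the shifted problem\<close>

text \<open>Testing with \<open>v = 0\<close> moves the term
  \<open>d (k - 1) \<gamma> \<bullet> d (k - 1) \<tau>\<close> to the side of \<open>u\<close>, so
  it is the shifted function whose adjoint value is identified. Testing with
  \<open>\<tau> = 0\<close> and integrating by parts in \<open>\<sigma>\<close> gives the equation
  for \<open>L\<close>.\<close>

lemma mixed_solution_imp_shifted:
  assumes \<gamma>: "\<gamma> \<in> V (k - 1)" and \<sigma>: "\<sigma> \<in> V (k - 1)" and u: "u \<in> V k"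
    and eq: "\<And>\<tau> v. \<tau> \<in> V (k - 1) \<Longrightarrow> v \<in> V k \<Longrightarrow> B (\<sigma>, u) (\<tau>, v) =
      \<gamma> \<bullet> \<tau> + d (k - 1) \<gamma> \<bullet> d (k - 1) \<tau> + (p \<bullet> v + q \<bullet> d k v)"
  shows "u + d (k - 1) \<gamma> \<in> X" "\<sigma> = \<delta> (u + d (k - 1) \<gamma>) + l2 u + \<gamma>"
    "L (u + d (k - 1) \<gamma>) = shifted_load \<gamma> p q"
proof -
  let ?w = "u + d (k - 1) \<gamma>"
  have zero: "0 \<in> V j" "d j 0 = 0" for j
    using subspace_0[OF V_subspace] d_scale[of 0 j 0] by auto
  have eq1: "d (k - 1) \<tau> \<bullet> ?w = \<tau> \<bullet> (\<sigma> - l2 u - \<gamma>)" if "\<tau> \<in> V (k - 1)" for \<tau>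
    using eq[OF that zero(1)]
    by (simp add: B_form_def zero inner_commute algebra_simps)
  have eq2: "d k u \<bullet> d k v + d (k - 1) \<sigma> \<bullet> v + l3 \<sigma> \<bullet> v + l1 u \<bullet> d k v + l4 (d k u) \<bullet> v + l5 u \<bullet> v
    = p \<bullet> v + q \<bullet> d k v" if "v \<in> V k" for v
    using eq[OF zero(1) that] by (simp add: B_form_def zero)
  have W: "?w \<in> V k" "\<sigma> - l2 u - \<gamma> \<in> W (k - 1)"
    using u \<sigma> \<gamma> d_in_V V_in_W maps V_subspace W_subspace by (auto intro!: subspace_add subspace_diff)
  have "?w \<in> Vstar W V d k" and \<delta>w: "\<delta> ?w = \<sigma> - l2 u - \<gamma>"
    using VstarI[of ?w k] W eq1 V_in_W by auto
  then show X: "?w \<in> X" and s: "\<sigma> = \<delta> ?w + l2 u + \<gamma>" using W by (auto simp: VVstar_def)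
  have "\<sigma> \<bullet> \<delta> v = d (k - 1) \<sigma> \<bullet> v" if "v \<in> X" for v
    using VstarD(3)[OF _ \<sigma>] that by (simp add: VVstar_def)
  then show "L ?w = shifted_load \<gamma> p q"
    using eq2 by (subst L_eq_shifted_load_iff[OF \<gamma> X _ s])
      (auto simp: VVstar_def algebra_simps)
qed

lemma shifted_imp_mixed_solution:
  assumes \<gamma>: "\<gamma> \<in> V (k - 1)" and p: "p \<in> W k" and w: "w \<in> X"
    and L: "L w = shifted_load \<gamma> p q"
    and u: "u = w - d (k - 1) \<gamma>" and s: "\<sigma> = \<delta> w + l2 u + \<gamma>"
  shows "\<sigma> \<in> V (k - 1)" "u \<in> V k"
    "\<And>\<tau> v. \<tau> \<in> V (k - 1) \<Longrightarrow> v \<in> V k \<Longrightarrow> B (\<sigma>, u) (\<tau>, v) =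
      \<gamma> \<bullet> \<tau> + d (k - 1) \<gamma> \<bullet> d (k - 1) \<tau> + (p \<bullet> v + q \<bullet> d k v)"
proof -
  note eq = L[unfolded L_eq_shifted_load_iff[OF \<gamma> w u s], rule_format]
  \<comment> \<open>The terms paired with \<open>v\<close> itself, rather than with
    \<open>d k v\<close> or \<open>\<delta> v\<close>.\<close>
  define m where "m = p - l3 \<sigma> - l4 (d k u) - l5 u"
  show uV: "u \<in> V k" using w d_in_V[OF \<gamma>] V_subspace by (auto simp: u VVstar_def intro: subspace_diff)
  have wV: "w \<in> Vstar W V d k" using w by (simp add: VVstar_def)
  have sW: "\<sigma> \<in> W (k - 1)"
    using VstarD(2)[OF wV] maps V_in_W[OF uV] V_in_W[OF \<gamma>] W_subspace by (auto simp: s intro!: subspace_add)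
  have "d k u \<in> W (k + 1)" using d_range uV by blast
  then have mW: "m \<in> W k"
    using p sW maps V_in_W[OF uV] W_subspace by (auto simp: m_def intro!: subspace_diff)
  \<comment> \<open>On the range \<open>d k z = 0\<close>, so \<open>q\<close> and
    \<open>d k u + l1 u\<close> drop out.\<close>
  have test: "\<sigma> \<bullet> \<delta> z = m \<bullet> z" if "z \<in> Vstar W V d k" "z \<in> d (k - 1) ` V (k - 1)" for z
    using eq[of z] that d_in_V d_d_eq_0 by (auto simp: VVstar_def m_def algebra_simps)
  show \<sigma>: "\<sigma> \<in> V (k - 1)"
    by (rule V_by_testing_on_range(1)[OF sW mW test])
  have d\<sigma>: "d (k - 1) \<sigma> \<bullet> b = m \<bullet> b" if "b \<in> d (k - 1) ` V (k - 1)" for b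
    by (rule V_by_testing_on_range(2)[OF sW mW test that])
  \<comment> \<open>Passes from \<open>X\<close> to all of \<open>V k\<close>: \<open>v - b\<close>
    is an admissible test function with \<open>\<delta> (v - b) = 0\<close>, while on
    \<open>b\<close> the identity is \<open>d\<sigma>\<close>.\<close>
  have eq2: "(d k u + l1 u) \<bullet> d k v + d (k - 1) \<sigma> \<bullet> v = m \<bullet> v + q \<bullet> d k v" if v: "v \<in> V k" for v
  proof -
    obtain b where b: "b \<in> d (k - 1) ` V (k - 1)" "v - b \<in> Vstar W V d k" "\<delta> (v - b) = 0"
      using hodge_splitting[OF V_in_W[OF v]] by blast
    have bV: "b \<in> V k" "d k b = 0" using b(1) d_in_V d_d_eq_0 by auto
    then have X: "v - b \<in> X" and dv: "d k (v - b) = d k v"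
      using v b(2) V_subspace by (auto simp: VVstar_def d_diff subspace_diff)
    have "d (k - 1) \<sigma> \<bullet> (v - b) = 0" using VstarD(3)[OF b(2) \<sigma>] b(3) by simp
    then show ?thesis using eq[OF X] d\<sigma>[OF b(1)] b(3)
      unfolding dv by (simp add: m_def algebra_simps)
  qed
  fix \<tau> v assume \<tau>: "\<tau> \<in> V (k - 1)" and v: "v \<in> V k"
  show "B (\<sigma>, u) (\<tau>, v) =
      \<gamma> \<bullet> \<tau> + d (k - 1) \<gamma> \<bullet> d (k - 1) \<tau> + (p \<bullet> v + q \<bullet> d k v)"
    using eq2[OF v] VstarD(3)[OF wV \<tau>]
    by (simp add: B_form_def u[symmetric] m_def s[symmetric])
      (simp add: s u algebra_simps inner_commute)
qed

section \<open>Well-posedness of both problems\<close>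

theorem perturbed_well_posed:
  assumes bij: "bij_betw L X (dual X (VVstar_norm W V d k))" and f: "f \<in> W k"
  shows "\<exists>!u. u \<in> L_domain W V d k l1 l2 \<and> L u = to_dual X f"
proof (rule ex_ex1I)
  have zero: "0 \<in> V (k - 1)" "d (k - 1) 0 = 0"
    using subspace_0[OF V_subspace] d_scale[of 0 "k - 1" 0] by auto
  have l_zero: "l1 0 = 0" "l2 0 = 0" "l3 0 = 0" "l5 0 = 0"
    using l1 l2 l3 l5 W_subspace by (auto simp: bounded_linear_map_def intro: linear_on_zero)
  have load: "shifted_load 0 f 0 = to_dual X f"
    by (auto simp: shifted_load_def to_dual_def zero l_zero)
  then obtain u where u: "u \<in> X" "L u = shifted_load 0 f 0"
    using bij shifted_load_in_dual by (metis bij_betw_def imageE)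
  define \<sigma> where "\<sigma> = \<delta> u + l2 u"
  note sol = shifted_imp_mixed_solution[OF zero(1) f u, of u \<sigma>]
  have \<sigma>: "\<sigma> \<in> V (k - 1)" and uV: "u \<in> V k" using sol(1,2) by (auto simp: zero \<sigma>_def)
  \<comment> \<open>The second mixed equation holds for every \<open>v\<close> in
    \<open>V k\<close>, as membership in the domain of the adjoint of \<open>d k\<close> requires;
    \<open>L u = to_dual X f\<close> by itself tests only with \<open>X\<close>.\<close>
  have "d k v \<bullet> (d k u + l1 u) = v \<bullet> (f - d (k - 1) \<sigma> - l3 \<sigma> - l4 (d k u) - l5 u)" if "v \<in> V k" for v
    using sol(3)[OF _ _ zero(1) that]
    by (simp add: zero \<sigma>_def B_form_def inner_commute algebra_simps)
  moreover have "d k u \<in> W (k + 1)" "l1 u \<in> W (k + 1)"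
    using d_range uV V_in_W l1 by (auto simp: bounded_linear_map_def)
  moreover have "f - d (k - 1) \<sigma> - l3 \<sigma> - l4 (d k u) - l5 u \<in> W k"
    using f \<sigma> uV V_in_W d_in_W maps W_subspace d_range[of k]
    by (auto intro!: subspace_diff)
  ultimately have "d k u + l1 u \<in> Vstar W V d (k + 1)"
    using W_subspace by (intro VstarI(1)) (auto intro: subspace_add)
  then show "\<exists>u. u \<in> L_domain W V d k l1 l2 \<and> L u = to_dual X f"
    using u \<sigma> load by (auto simp: L_domain_def \<sigma>_def)
  show "u = v" if "u \<in> L_domain W V d k l1 l2 \<and> L u = to_dual X f"
    "v \<in> L_domain W V d k l1 l2 \<and> L v = to_dual X f" for u v
    using that bij inj_onD[of L X u v] by (auto simp: L_domain_def bij_betw_def)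
qed

text \<open>Surjectivity of \<open>L\<close> gives \<open>w\<close>, hence a solution. Injectivity
  makes every solution have this same \<open>w\<close>, which determines \<open>u\<close> and then
  \<open>\<sigma>\<close>.\<close>

theorem mixed_well_posed:
  assumes bij: "bij_betw L X (dual X (VVstar_norm W V d k))"
    and g: "g \<in> dual (V (k - 1)) (V_norm d (k - 1))" and f: "f \<in> dual (V k) (V_norm d k)"
  shows "\<exists>!x. x \<in> V (k - 1) \<times> V k \<and> (\<forall>\<tau>\<in>V (k - 1). \<forall>v\<in>V k. B x (\<tau>, v) = g \<tau> + f v)"
proof -
  obtain \<gamma> where \<gamma>: "\<gamma> \<in> V (k - 1)"
    "\<And>\<tau>. \<tau> \<in> V (k - 1) \<Longrightarrow> g \<tau> = \<gamma> \<bullet> \<tau> + d (k - 1) \<gamma> \<bullet> d (k - 1) \<tau>"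
    using V_dual_representation[OF g] by blast
  obtain \<phi> where \<phi>: "\<phi> \<in> V k" "\<And>v. v \<in> V k \<Longrightarrow> f v = \<phi> \<bullet> v + d k \<phi> \<bullet> d k v"
    using V_dual_representation[OF f] by blast
  obtain w where w: "w \<in> X" "L w = shifted_load \<gamma> \<phi> (d k \<phi>)"
    using bij shifted_load_in_dual by (metis bij_betw_def imageE)
  define u where "u = w - d (k - 1) \<gamma>"
  define \<sigma> where "\<sigma> = \<delta> w + l2 u + \<gamma>"
  show ?thesis
  proof (rule ex1I[of _ "(\<sigma>, u)"])
    show "(\<sigma>, u) \<in> V (k - 1) \<times> V k \<and> (\<forall>\<tau>\<in>V (k - 1). \<forall>v\<in>V k. B (\<sigma>, u) (\<tau>, v) = g \<tau> + f v)"
      using shifted_imp_mixed_solution[OF \<gamma>(1) V_in_W[OF \<phi>(1)] w u_def \<sigma>_def] \<gamma>(2) \<phi>(2) by auto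
  next
    fix x assume x: "x \<in> V (k - 1) \<times> V k \<and> (\<forall>\<tau>\<in>V (k - 1). \<forall>v\<in>V k. B x (\<tau>, v) = g \<tau> + f v)"
    obtain s t where st: "x = (s, t)" by force
    have "t + d (k - 1) \<gamma> \<in> X" "s = \<delta> (t + d (k - 1) \<gamma>) + l2 t + \<gamma>"
      "L (t + d (k - 1) \<gamma>) = shifted_load \<gamma> \<phi> (d k \<phi>)"
      using mixed_solution_imp_shifted[OF \<gamma>(1), of s t \<phi> "d k \<phi>"] x \<gamma>(2) \<phi>(2) st by auto
    moreover from this have "t + d (k - 1) \<gamma> = w"
      using bij w by (metis bij_betw_def inj_onD)
    ultimately show "x = (\<sigma>, u)" by (auto simp: st u_def \<sigma>_def)
  qed
qed

end

theorem theorem3p1: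
  fixes W V :: "int \<Rightarrow> 'a::{real_inner, complete_space} set"
    and d :: "int \<Rightarrow> 'a \<Rightarrow> 'a"
    and k :: int
    and l1 l2 l3 l4 l5 :: "'a \<Rightarrow> 'a"
  assumes "hilbert_complex W V d"
    and "compactness_property W V d"
    and "bounded_linear_map (W k) (W (k + 1)) l1"
    and "bounded_linear_map (W k) (W (k - 1)) l2"
    and "bounded_linear_map (W (k - 1)) (W k) l3"
    and "bounded_linear_map (W (k + 1)) (W k) l4"
    and "bounded_linear_map (W k) (W k) l5"
    and "bounded_iso_to_dual (VVstar W V d k) (VVstar_norm W V d k) (L_op W V d k l1 l2 l3 l4 l5)"
    and "(\<lambda>u. dstar W V d k u + l2 u) `
           preimage_W (VVstar W V d k) (W k) (L_op W V d k l1 l2 l3 l4 l5) \<subseteq> V (k - 1)"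
    and "(\<lambda>z. dstar W V d k z + adj (W (k - 1)) (W (k - 1)) l3 z) `
           preimage_W (VVstar W V d k) (W k) (L_op_dual W V d k l1 l2 l3 l4 l5) \<subseteq> V (k - 1)"
  shows "(\<forall>f\<in>W k. \<exists>!u. u \<in> L_domain W V d k l1 l2 \<and>
             L_op W V d k l1 l2 l3 l4 l5 u = to_dual (VVstar W V d k) f) \<and>
         (\<forall>g\<in>dual (V (k - 1)) (V_norm d (k - 1)). \<forall>f\<in>dual (V k) (V_norm d k).
             \<exists>!p. p \<in> V (k - 1) \<times> V k \<and>
               (\<forall>\<tau>\<in>V (k - 1). \<forall>v\<in>V k. B_form d k l1 l2 l3 l4 l5 p (\<tau>, v) = g \<tau> + f v))"
proof -
  interpret perturbed_complex W V d k l1 l2 l3 l4 l5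
    using assms(1,3-7) by (simp add: perturbed_complex_def perturbed_complex_axioms_def)
  have "bij_betw L X (dual X (VVstar_norm W V d k))"
    using assms(8) by (simp add: bounded_iso_to_dual_def)
  then show ?thesis using perturbed_well_posed mixed_well_posed by blast
qed

end
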